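(* Let $n_1,n_2\ge 0$ be integers, let $\Omega\subset\mathbb C$ be a (closed, compact) Jordan domain bounded by a Jordan curve $\Gamma=\partial\Omega$, and let $f\in\mathbf C_A(\Omega)\setminus\mathscr R_{(n_1,n_2)}$. Let $\hat\xi_\Omega\in\mathscr R_{(n_1,n_2)}$ be a minimax approximant of $f$ on $\Omega$, i.e. $\|f-\hat\xi_\Omega\|_{\infty,\Omega}=\inf_{\xi\in\mathscr R_{(n_1,n_2)}}\|f-\xi\|_{\infty,\Omega}$, and assume that it satisfies Ruttan's sufficient condition: there exist points $\{z_j\}_{j=1}^r\subseteq\mathcal E(\hat\xi_\Omega)$, $r\ge1$, and positive reals $\{\omega_j\}_{j=1}^r$ with $\sum_{j=1}^r\omega_j=1$ such that the Hermitian matrix $\sum_{j=1}^r\omega_jH(z_j)$ is positive semi-definite, with $H(x)$ as defined in the context. Then: (i) $\hat\xi_\Omega$ is also a minimax approximant of $f$ on $\Gamma$ from $\mathscr R_{(n_1,n_2)}$, i.e. $\|f-\hat\xi_\Omega\|_{\infty,\Gamma}=\inf_{\xi\in\mathscr R_{(n_1,n_2)}}\|f-\xi\|_{\infty,\Gamma}$; (ii) if $\mathcal X=\{x_j\}_{j=1}^m\subset\Gamma$ is a finite set of $m\ge n_1+n_2+2$ distinct points that contains a set of extreme points $\{z_j\}_{j=1}^r\subseteq\mathcal E(\hat\xi_\Omega)\subset\Gamma$ for which Ruttan's sufficient condition holds (i.e. for some positive $\omega_j$ with $\sum_{j=1}^r\omega_j=1$ the matrix $\sum_{j=1}^r\omega_jH(z_j)$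 is positive semi-definite), then $\hat\xi_\Omega$ is also a minimax approximant of $f$ on $\mathcal X$ from $\mathscr R_{(n_1,n_2)}$, i.e. $\|f-\hat\xi_\Omega\|_{\infty,\mathcal X}=\inf_{\xi\in\mathscr R_{(n_1,n_2)}}\|f-\xi\|_{\infty,\mathcal X}$.
   Context: $\mathbb P_k$ is the space of complex polynomials of degree at most $k$. $\mathscr R_{(n_1,n_2)}=\{p/q: p\in\mathbb P_{n_1},\ 0\not\equiv q\in\mathbb P_{n_2}\}$; a rational function is identified with its irreducible representation. $\mathbf C_A(\Omega)$ is the class of complex functions continuous on $\Omega$ (including its boundary $\Gamma$) and analytic in the interior of $\Omega$. For a compact set $\mathcal B$, $\|h\|_{\infty,\mathcal B}=\sup_{x\in\mathcal B}|h(x)|$, taken to be infinite if $h$ has a pole in $\mathcal B$. Put $\hat e=f-\hat\xi_\Omega$ and $\mathcal E(\hat\xi_\Omega)=\{x\in\Omega:\ |f(x)-\hat\xi_\Omega(x)|=\|\hat e\|_{\infty,\Omega}\}$. Let $N=n_1+n_2+2$ and fix bases $\psi_0,\dots,\psi_{n_1}$ of $\mathbb P_{n_1}$ and $\phi_0,\dots,\phi_{n_2}$ of $\mathbb P_{n_2}$ (definiteness does not depend on the choice). Define $$H(x)=\begin{bmatrix}H_1(x)&H_3(x)\\ H_3(x)^{\mathrm H}&H_2(x)\end{bmatrix}\in\mathbb C^{N\times N},$$ where $^{\mathrm H}$ is conjugate transpose and $[H_1(x)]_{\ell,k}=\overline{\psi_{\ell-1}(x)}\psi_{k-1}(x)$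 for $1\le\ell,k\le n_1+1$; $[H_2(x)]_{\ell,k}=\left(|f(x)|^2-\|\hat e\|_{\infty,\Omega}^2\right)\overline{\phi_{\ell-1}(x)}\phi_{k-1}(x)$ for $1\le\ell,k\le n_2+1$; $[H_3(x)]_{\ell,k}=-f(x)\overline{\psi_{\ell-1}(x)}\phi_{k-1}(x)$ for $1\le\ell\le n_1+1$, $1\le k\le n_2+1$.
   Formalization: Part (i) is stated only when f − ξ̂_Ω is not constant on Ω (then E(ξ̂_Ω) ⊂ Γ is proved). For a constant error, possible only if n1 < n2, (i) can fail: e.g. f = 1/z − c, ξ̂ = 1/z on a suitable Ω, where an approximant with a pole inside Ω is better on Γ. *)

theory Defs
  imports
    "HOL-Analysis.Analysis"
    "HOL-Computational_Algebra.Computational_Algebra"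
    "HOL-Computational_Algebra.Field_as_Ring"
    "Jordan_Normal_Form.Schur_Decomposition"
begin

definition closed_jordan_domain :: "complex set \<Rightarrow> complex set \<Rightarrow> bool" where
  "closed_jordan_domain \<Omega> \<Gamma> \<longleftrightarrow>
     (\<exists>\<gamma>. simple_path \<gamma> \<and> pathfinish \<gamma> = pathstart \<gamma> \<and> \<Gamma> = path_image \<gamma>) \<and>
     \<Omega> = \<Gamma> \<union> inside \<Gamma>"

definition C_A :: "complex set \<Rightarrow> (complex \<Rightarrow> complex) set" where
  "C_A \<Omega> = {f. continuous_on \<Omega> f \<and> f analytic_on interior \<Omega>}"

text \<open>
  Rational functions are elements of the fraction field of the polynomial ring.
  The irreducible representation of \<open>\<xi>\<close> is the coprime pair \<open>quot_of_fract \<xi>\<close>,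
  and poles and values are read off from that pair.
\<close>

definition rat_class :: "nat \<Rightarrow> nat \<Rightarrow> complex poly fract set" where
  "rat_class n1 n2 = {Fract p q | p q. degree p \<le> n1 \<and> q \<noteq> 0 \<and> degree q \<le> n2}"

definition rat_poles :: "complex poly fract \<Rightarrow> complex set" where
  "rat_poles \<xi> = {x. poly (snd (quot_of_fract \<xi>)) x = 0}"

definition rat_eval :: "complex poly fract \<Rightarrow> complex \<Rightarrow> complex" where
  "rat_eval \<xi> x = poly (fst (quot_of_fract \<xi>)) x / poly (snd (quot_of_fract \<xi>)) x"

definition agrees_with_rational_on :: "(complex \<Rightarrow> complex) \<Rightarrow> nat \<Rightarrow> nat \<Rightarrow> complex set \<Rightarrow> bool" where
  "agrees_with_rational_on f n1 n2 B \<longleftrightarrow>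
     (\<exists>\<xi>\<in>rat_class n1 n2. rat_poles \<xi> \<inter> B = {} \<and> (\<forall>x\<in>B. f x = rat_eval \<xi> x))"

text \<open>The uniform norm of \<open>f - \<xi>\<close> on \<open>B\<close>, for \<open>f\<close> finite-valued on \<open>B\<close>.\<close>

definition err_norm :: "(complex \<Rightarrow> complex) \<Rightarrow> complex poly fract \<Rightarrow> complex set \<Rightarrow> ennreal" where
  "err_norm f \<xi> B =
     (if rat_poles \<xi> \<inter> B \<noteq> {} then \<infinity>
      else (SUP x\<in>B. ennreal (cmod (f x - rat_eval \<xi> x))))"

definition is_minimax ::
  "nat \<Rightarrow> nat \<Rightarrow> (complex \<Rightarrow> complex) \<Rightarrow> complex set \<Rightarrow> complex poly fract \<Rightarrow> bool" where
  "is_minimax n1 n2 f B \<xi> \<longleftrightarrow>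
     \<xi> \<in> rat_class n1 n2 \<and> err_norm f \<xi> B = (INF \<eta>\<in>rat_class n1 n2. err_norm f \<eta> B)"

definition extreme_points ::
  "(complex \<Rightarrow> complex) \<Rightarrow> complex poly fract \<Rightarrow> complex set \<Rightarrow> complex set" where
  "extreme_points f \<xi> \<Omega> = {x \<in> \<Omega>. ennreal (cmod (f x - rat_eval \<xi> x)) = err_norm f \<xi> \<Omega>}"

definition poly_basis :: "nat \<Rightarrow> (nat \<Rightarrow> complex poly) \<Rightarrow> bool" where
  "poly_basis n \<psi> \<longleftrightarrow>
     inj_on \<psi> {0..n} \<and>
     \<not> Modules.module.dependent Polynomial.smult (\<psi> ` {0..n}) \<and>
     Modules.module.span Polynomial.smult (\<psi> ` {0..n}) = {p. degree p \<le> n}"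

text \<open>
  Rows and columns are numbered from 0. The parameter \<open>\<sigma>\<close> stands for the uniform norm of the
  error on \<open>\<Omega>\<close>.
\<close>

definition H_mat ::
  "nat \<Rightarrow> nat \<Rightarrow> (nat \<Rightarrow> complex poly) \<Rightarrow> (nat \<Rightarrow> complex poly) \<Rightarrow>
   (complex \<Rightarrow> complex) \<Rightarrow> real \<Rightarrow> complex \<Rightarrow> complex mat" where
  "H_mat n1 n2 \<psi> \<phi> f \<sigma> x =
     (let H1 = Matrix.mat (n1 + 1) (n1 + 1)
                 (\<lambda>(l, k). cnj (poly (\<psi> l) x) * poly (\<psi> k) x);
          H2 = Matrix.mat (n2 + 1) (n2 + 1)
                 (\<lambda>(l, k). complex_of_real ((cmod (f x))\<^sup>2 - \<sigma>\<^sup>2) * cnj (poly (\<phi> l) x) * poly (\<phi> k) x);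
          H3 = Matrix.mat (n1 + 1) (n2 + 1)
                 (\<lambda>(l, k). - f x * cnj (poly (\<psi> l) x) * poly (\<phi> k) x)
      in four_block_mat H1 H3 (mat_adjoint H3) H2)"

text \<open>Since \<open>u \<bullet>c v\<close> is conjugate linear in \<open>v\<close>, the form below is \<open>v\<^sup>H A v\<close>.\<close>

definition pos_semidef :: "complex mat \<Rightarrow> bool" where
  "pos_semidef A \<longleftrightarrow>
     square_mat A \<and> mat_adjoint A = A \<and>
     (\<forall>v\<in>carrier_vec (dim_row A). 0 \<le> Re ((A *\<^sub>v v) \<bullet>c v))"

text \<open>
  Ruttan's sufficient condition for \<open>\<xi>\<close> on \<open>\<Omega>\<close>, witnessed by extreme points that lie in \<open>S\<close>.
  Both the extreme points and the matrix refer to the error norm on \<open>\<Omega>\<close>, whatever \<open>S\<close> is.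
  \<open>enn2real\<close> loses nothing for a minimax approximant of a bounded function: its error norm is
  finite. If the norm is infinite, there are no extreme points.
\<close>

definition ruttan_condition ::
  "nat \<Rightarrow> nat \<Rightarrow> (nat \<Rightarrow> complex poly) \<Rightarrow> (nat \<Rightarrow> complex poly) \<Rightarrow> (complex \<Rightarrow> complex) \<Rightarrow>
   complex set \<Rightarrow> complex poly fract \<Rightarrow> complex set \<Rightarrow> bool" where
  "ruttan_condition n1 n2 \<psi> \<phi> f \<Omega> \<xi> S \<longleftrightarrow>
     (\<exists>(r::nat) (z :: nat \<Rightarrow> complex) (\<omega> :: nat \<Rightarrow> real).
        1 \<le> r \<and>
        z ` {1..r} \<subseteq> extreme_points f \<xi> \<Omega> \<and> z ` {1..r} \<subseteq> S \<and>
        (\<forall>j\<in>{1..r}. 0 < \<omega> j) \<and> (\<Sum>j=1..r. \<omega> j) = 1 \<and>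
        pos_semidef (Matrix.mat (n1 + n2 + 2) (n1 + n2 + 2)
          (\<lambda>(i, k). \<Sum>j=1..r. complex_of_real (\<omega> j) *
             H_mat n1 n2 \<psi> \<phi> f (enn2real (err_norm f \<xi> \<Omega>)) (z j) $$ (i, k))))"

text \<open>
  The maximum modulus principle puts all extreme points on \<open>\<Gamma>\<close> exactly when \<open>f - \<xi>\<close> is not
  constant on \<open>\<Omega>\<close>. The constant case can occur if \<open>n1 < n2\<close>: for \<open>n1 = 0\<close>, \<open>n2 = 1\<close> take
  \<open>f x = 1 / x - c\<close> with \<open>c \<noteq> 0\<close> and \<open>\<xi> x = 1 / x\<close>. Then every point of \<open>\<Omega>\<close> is extreme, Ruttan's
  condition may hold only with the help of interior points, and an approximant with a pole inside
  \<open>\<Omega>\<close> may be strictly better than \<open>\<xi>\<close> on \<open>\<Gamma>\<close>.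
\<close>

end

(*
  If v collects the coefficients of p and q in the two bases, then
  v^H H(x) v = |p(x) - f(x) q(x)|^2 - sigma^2 |q(x)|^2. An approximant p/q with error below
  sigma at all the points z_j makes each of these numbers negative, so the weighted sum of the
  H(z_j) could not be positive semi-definite. Hence the approximant is optimal on every subset
  of Omega that contains the z_j. For the boundary, the maximum modulus principle puts all
  extreme points of a nonconstant error on Gamma.
*)
theory Submission
  imports Defs "HOL-Complex_Analysis.Conformal_Mappings"
begin

section \<open>Rational functions\<close>

text \<open>Members of \<open>rat_class\<close> are given by arbitrary, possibly reducible,
  fractions, while evaluation and poles use the coprime pair. Cancelling a common factor
  \<open>d\<close> only lowers degrees.\<close>

lemma rat_class_degree_le:
  assumes "\<eta> \<in> rat_class n1 n2"
  shows "degree (fst (quot_of_fract \<eta>)) \<le> n1" and "degree (snd (quot_of_fract \<eta>)) \<le> n2"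
proof -
  obtain p q where \<eta>: "\<eta> = Fract p q" and p: "degree p \<le> n1" and q: "q \<noteq> 0" "degree q \<le> n2"
    using assms unfolding rat_class_def by blast
  have "quot_of_fract \<eta> = normalize_quot (p, q)"
    using q(1) quot_of_fract_quot_to_fract[of "(p, q)"] by (simp add: \<eta> quot_to_fract_def)
  with normalize_quotE[OF q(1), of p] obtain d where
    d: "p = fst (quot_of_fract \<eta>) * d" "q = snd (quot_of_fract \<eta>) * d" "d \<noteq> 0"
    by metis
  show "degree (fst (quot_of_fract \<eta>)) \<le> n1"
    \<comment> \<open>The numerator may be zero, where \<open>degree_mult_eq\<close> does not apply;
      the denominator cannot, since \<open>q \<noteq> 0\<close>.\<close>
    using p d(1,3) by (cases "fst (quot_of_fract \<eta>) = 0") (auto simp: degree_mult_eq)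
  show "degree (snd (quot_of_fract \<eta>)) \<le> n2"
    using q d(2) by (auto simp: degree_mult_eq)
qed

lemma rat_eval_holomorphic_on:
  assumes "rat_poles \<xi> \<inter> S = {}"
  shows "rat_eval \<xi> holomorphic_on S"
proof -
  have "(\<lambda>x. poly (fst (quot_of_fract \<xi>)) x / poly (snd (quot_of_fract \<xi>)) x) holomorphic_on S"
    using assms by (intro holomorphic_intros) (auto simp: rat_poles_def)
  then show ?thesis
    by (simp add: rat_eval_def[abs_def])
qed

lemma err_norm_upper:
  "x \<in> B \<Longrightarrow> ennreal (cmod (f x - rat_eval \<xi> x)) \<le> err_norm f \<xi> B"
  by (auto simp: err_norm_def intro: SUP_upper)

lemma err_norm_mono: "A \<subseteq> B \<Longrightarrow> err_norm f \<xi> A \<le> err_norm f \<xi> B"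
  by (auto simp: err_norm_def intro: SUP_subset_mono)

text \<open>A pole would make the norm infinite, and no pointwise error attains that value.\<close>

lemma extreme_point_imp_no_poles:
  assumes "z \<in> extreme_points f \<xi> \<Omega>"
  shows "rat_poles \<xi> \<inter> \<Omega> = {}"
  using assms by (auto simp: extreme_points_def err_norm_def split: if_splits)

lemma extreme_point_modulus:
  assumes "z \<in> extreme_points f \<xi> \<Omega>"
  shows "cmod (f z - rat_eval \<xi> z) = enn2real (err_norm f \<xi> \<Omega>)"
proof -
  have "err_norm f \<xi> \<Omega> = ennreal (cmod (f z - rat_eval \<xi> z))"
    using assms by (simp add: extreme_points_def)
  then show ?thesis by simp
qed

text \<open>A single extreme point in \<open>B\<close> already realizes the full norm. This lets the
  level \<open>\<sigma>\<close> taken from \<open>\<Omega>\<close> serve for a subset.\<close>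

lemma err_norm_subset_eq:
  assumes "z \<in> extreme_points f \<xi> \<Omega>" "z \<in> B" "B \<subseteq> \<Omega>"
  shows "err_norm f \<xi> B = err_norm f \<xi> \<Omega>"
proof (rule antisym)
  show "err_norm f \<xi> \<Omega> \<le> err_norm f \<xi> B"
    using assms err_norm_upper[of z B f \<xi>] by (simp add: extreme_points_def)
qed (use assms err_norm_mono in blast)

section \<open>Quadratic forms\<close>

lemma sum_lessThan_add:
  fixes g :: "nat \<Rightarrow> 'a::comm_monoid_add"
  shows "(\<Sum>i<m + n. g i) = (\<Sum>i<m. g i) + (\<Sum>i<n. g (m + i))"
  by (induction n) (simp_all add: add.assoc)

text \<open>Membership in the span gives coefficients indexed by the basis polynomials themselves;
  injectivity of \<open>\<psi>\<close> reindexes them by numbers.\<close>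

lemma poly_basis_expand:
  assumes "poly_basis n \<psi>" "degree p \<le> n"
  obtains a where "\<And>x. poly p x = (\<Sum>k<Suc n. a k * poly (\<psi> k) x)"
proof -
  interpret m: Modules.module "Polynomial.smult :: complex \<Rightarrow> _"
    by unfold_locales (simp_all add: Polynomial.smult_add_right Polynomial.smult_add_left)
  have "p \<in> m.span (\<psi> ` {0..n})"
    using assms by (simp add: poly_basis_def)
  then obtain u where "p = (\<Sum>v\<in>\<psi> ` {0..n}. Polynomial.smult (u v) v)"
    by (auto simp: m.span_finite)
  also have "\<dots> = (\<Sum>k<Suc n. Polynomial.smult (u (\<psi> k)) (\<psi> k))"
    using assms(1) by (subst sum.reindex) (auto simp: poly_basis_def atLeast0AtMost lessThan_Suc_atMost)
  finally have "poly p x = (\<Sum>k<Suc n. u (\<psi> k) * poly (\<psi> k) x)" for x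
    by (simp add: poly_sum del: sum.lessThan_Suc)
  then show thesis by (rule that)
qed

text \<open>With \<open>u\<close> read as a row vector, the matrix is \<open>u\<close> conjugate
  transposed times \<open>u\<close>, so its form at \<open>c\<close> is the squared modulus of the
  number \<open>u c\<close>.\<close>

lemma rank_one_form:
  fixes u c :: "nat \<Rightarrow> complex"
  shows "(\<Sum>i<n. \<Sum>k<n. cnj (u i) * u k * c k * cnj (c i)) =
    complex_of_real ((cmod (\<Sum>k<n. u k * c k))\<^sup>2)"
proof -
  have "(\<Sum>i<n. \<Sum>k<n. cnj (u i) * u k * c k * cnj (c i)) =
      cnj (\<Sum>k<n. u k * c k) * (\<Sum>k<n. u k * c k)"
    unfolding cnj_sum sum_product complex_cnj_mult by (simp only: mult_ac)
  then show ?thesis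
    by (simp only: complex_norm_square mult.commute)
qed

text \<open>By linearity, a weighted sum of differences of two rank-one matrices reduces to
  \<open>rank_one_form\<close>. The vectors are functions on \<open>nat\<close>, so that only finite
  sums have to be rearranged.\<close>

lemma hermitian_form_of_rank_one_sum:
  fixes u w :: "nat \<Rightarrow> nat \<Rightarrow> complex" and c :: "nat \<Rightarrow> complex" and \<omega> :: "nat \<Rightarrow> real"
  assumes "A = Matrix.mat n n (\<lambda>(i, k). \<Sum>j\<in>J. complex_of_real (\<omega> j) *
      (cnj (u j i) * u j k - complex_of_real s * cnj (w j i) * w j k))"
  shows "(A *\<^sub>v Matrix.vec n c) \<bullet>c Matrix.vec n c =
    complex_of_real (\<Sum>j\<in>J. \<omega> j *
      ((cmod (\<Sum>k<n. u j k * c k))\<^sup>2 - s * (cmod (\<Sum>k<n. w j k * c k))\<^sup>2))"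
proof -
  have "(A *\<^sub>v Matrix.vec n c) \<bullet>c Matrix.vec n c =
      (\<Sum>i<n. (\<Sum>k<n. (\<Sum>j\<in>J. complex_of_real (\<omega> j) *
        (cnj (u j i) * u j k - complex_of_real s * cnj (w j i) * w j k)) * c k) * cnj (c i))"
    by (simp add: assms scalar_prod_def atLeast0LessThan)
  also have "\<dots> = (\<Sum>i<n. \<Sum>k<n. \<Sum>j\<in>J. complex_of_real (\<omega> j) *
      (cnj (u j i) * u j k - complex_of_real s * cnj (w j i) * w j k) * c k * cnj (c i))"
    by (simp only: sum_distrib_right)
  \<comment> \<open>Two interchanges bring the sum over \<open>J\<close> outermost, so that each
    \<open>j\<close> can be treated alone.\<close>
  also have "\<dots> = (\<Sum>i<n. \<Sum>j\<in>J. \<Sum>k<n. complex_of_real (\<omega> j) *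
      (cnj (u j i) * u j k - complex_of_real s * cnj (w j i) * w j k) * c k * cnj (c i))"
    by (intro sum.cong refl sum.swap)
  also have "\<dots> = (\<Sum>j\<in>J. \<Sum>i<n. \<Sum>k<n. complex_of_real (\<omega> j) *
      (cnj (u j i) * u j k - complex_of_real s * cnj (w j i) * w j k) * c k * cnj (c i))"
    by (rule sum.swap)
  also have "\<dots> = (\<Sum>j\<in>J. complex_of_real (\<omega> j) *
      ((\<Sum>i<n. \<Sum>k<n. cnj (u j i) * u j k * c k * cnj (c i)) -
       complex_of_real s * (\<Sum>i<n. \<Sum>k<n. cnj (w j i) * w j k * c k * cnj (c i))))"
  proof (intro sum.cong refl)
    fix j
    have "complex_of_real (\<omega> j) *
        (cnj (u j i) * u j k - complex_of_real s * cnj (w j i) * w j k) * c k * cnj (c i) =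
      complex_of_real (\<omega> j) * (cnj (u j i) * u j k * c k * cnj (c i)) -
      complex_of_real (\<omega> j) * (complex_of_real s * (cnj (w j i) * w j k * c k * cnj (c i)))" for i k
      by (simp add: algebra_simps)
    then show "(\<Sum>i<n. \<Sum>k<n. complex_of_real (\<omega> j) *
        (cnj (u j i) * u j k - complex_of_real s * cnj (w j i) * w j k) * c k * cnj (c i)) =
      complex_of_real (\<omega> j) *
      ((\<Sum>i<n. \<Sum>k<n. cnj (u j i) * u j k * c k * cnj (c i)) -
       complex_of_real s * (\<Sum>i<n. \<Sum>k<n. cnj (w j i) * w j k * c k * cnj (c i)))"
      by (simp only: sum_subtractf sum_distrib_left[symmetric] right_diff_distrib)
  qed
  also have "\<dots> = complex_of_real (\<Sum>j\<in>J. \<omega> j *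
      ((cmod (\<Sum>k<n. u j k * c k))\<^sup>2 - s * (cmod (\<Sum>k<n. w j k * c k))\<^sup>2))"
    by (simp only: rank_one_form of_real_sum of_real_mult of_real_diff)
  finally show ?thesis .
qed

section \<open>The matrix of Ruttan's condition\<close>

text \<open>Applied to the coefficients of \<open>p\<close> followed by those of \<open>q\<close>,
  this row gives \<open>p - f q\<close> at \<open>x\<close>, and \<open>denominator_row\<close>
  gives \<open>q\<close> at \<open>x\<close>.\<close>

definition residual_row ::
  "nat \<Rightarrow> (nat \<Rightarrow> complex poly) \<Rightarrow> (nat \<Rightarrow> complex poly) \<Rightarrow> (complex \<Rightarrow> complex) \<Rightarrow>
   complex \<Rightarrow> nat \<Rightarrow> complex" where
  "residual_row n1 \<psi> \<phi> f x i =
     (if i < Suc n1 then poly (\<psi> i) x else - f x * poly (\<phi> (i - Suc n1)) x)"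

definition denominator_row ::
  "nat \<Rightarrow> (nat \<Rightarrow> complex poly) \<Rightarrow> complex \<Rightarrow> nat \<Rightarrow> complex" where
  "denominator_row n1 \<phi> x i = (if i < Suc n1 then 0 else poly (\<phi> (i - Suc n1)) x)"

lemma mat_adjoint_index:
  assumes "i < dim_col A" "j < dim_row A"
  shows "mat_adjoint A $$ (i, j) = conjugate (A $$ (j, i))"
  using assms by (simp add: mat_adjoint_def mat_of_rows_def)

lemma dim_mat_adjoint: "dim_row (mat_adjoint A) = dim_col A" "dim_col (mat_adjoint A) = dim_row A"
  by (simp_all add: mat_adjoint_def)

text \<open>The \<open>cmod (f x)\<close> part of the lower right block completes the other three
  blocks to the rank-one matrix of \<open>residual_row\<close>. What remains, in that block only, is
  \<open>- \<sigma>\<^sup>2\<close> times the rank-one matrix of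
  \<open>denominator_row\<close>.\<close>

lemma H_mat_index:
  assumes "i < n1 + n2 + 2" "k < n1 + n2 + 2"
  shows "H_mat n1 n2 \<psi> \<phi> f \<sigma> x $$ (i, k) =
    cnj (residual_row n1 \<psi> \<phi> f x i) * residual_row n1 \<psi> \<phi> f x k -
    complex_of_real (\<sigma>\<^sup>2) * cnj (denominator_row n1 \<phi> x i) * denominator_row n1 \<phi> x k"
proof -
  have "complex_of_real ((cmod (f x))\<^sup>2) = f x * cnj (f x)"
    by (rule complex_norm_square)
  then show ?thesis
    using assms
    by (auto simp: H_mat_def Let_def mat_adjoint_index dim_mat_adjoint residual_row_def
        denominator_row_def algebra_simps)
qed

text \<open>A nonnegative sum with positive weights cannot have only negative terms. The point
  \<open>z\<close> depends on \<open>p\<close> and \<open>q\<close>; the bound avoids division, so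
  \<open>q\<close> may vanish at some of the points.\<close>

lemma ruttan_condition_lower_bound:
  assumes ruttan: "ruttan_condition n1 n2 \<psi> \<phi> f \<Omega> \<xi> S"
    and bases: "poly_basis n1 \<psi>" "poly_basis n2 \<phi>"
    and degrees: "degree p \<le> n1" "degree q \<le> n2"
  obtains z where "z \<in> extreme_points f \<xi> \<Omega>" "z \<in> S"
    "enn2real (err_norm f \<xi> \<Omega>) * cmod (poly q z) \<le> cmod (f z * poly q z - poly p z)"
proof -
  define \<sigma> where "\<sigma> = enn2real (err_norm f \<xi> \<Omega>)"
  obtain r :: nat and z :: "nat \<Rightarrow> complex" and \<omega> :: "nat \<Rightarrow> real" where
    r: "1 \<le> r" and
    z: "\<And>j. j \<in> {1..r} \<Longrightarrow> z j \<in> extreme_points f \<xi> \<Omega>" "\<And>j. j \<in> {1..r} \<Longrightarrow> z j \<in> S" and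
    \<omega>: "\<And>j. j \<in> {1..r} \<Longrightarrow> 0 < \<omega> j" and
    psd: "pos_semidef (Matrix.mat (n1 + n2 + 2) (n1 + n2 + 2)
      (\<lambda>(i, k). \<Sum>j=1..r. complex_of_real (\<omega> j) * H_mat n1 n2 \<psi> \<phi> f \<sigma> (z j) $$ (i, k)))"
    using ruttan unfolding ruttan_condition_def \<sigma>_def image_subset_iff by blast
  obtain a where a: "\<And>x. poly p x = (\<Sum>k<Suc n1. a k * poly (\<psi> k) x)"
    using poly_basis_expand[OF bases(1) degrees(1)] by blast
  obtain b where b: "\<And>x. poly q x = (\<Sum>k<Suc n2. b k * poly (\<phi> k) x)"
    using poly_basis_expand[OF bases(2) degrees(2)] by blast
  \<comment> \<open>The coefficients are stacked in the block order of the matrix; the sign of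
    \<open>- f\<close> is already in \<open>residual_row\<close>.\<close>
  define c where "c i = (if i < Suc n1 then a i else b (i - Suc n1))" for i
  \<comment> \<open>This form of the dimension lets \<open>sum_lessThan_add\<close> split the sums
    at the block boundary.\<close>
  have N: "n1 + n2 + 2 = Suc n1 + Suc n2" by simp
  have res: "(\<Sum>k<n1 + n2 + 2. residual_row n1 \<psi> \<phi> f x k * c k) = poly p x - f x * poly q x" for x
    unfolding N sum_lessThan_add a b
    by (simp add: residual_row_def c_def sum_distrib_left sum_negf mult_ac del: sum.lessThan_Suc)
  have den: "(\<Sum>k<n1 + n2 + 2. denominator_row n1 \<phi> x k * c k) = poly q x" for x
    unfolding N sum_lessThan_add b
    by (simp add: denominator_row_def c_def mult_ac del: sum.lessThan_Suc)
  define A where "A = Matrix.mat (n1 + n2 + 2) (n1 + n2 + 2)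
      (\<lambda>(i, k). \<Sum>j=1..r. complex_of_real (\<omega> j) * H_mat n1 n2 \<psi> \<phi> f \<sigma> (z j) $$ (i, k))"
  have "A = Matrix.mat (n1 + n2 + 2) (n1 + n2 + 2) (\<lambda>(i, k). \<Sum>j=1..r. complex_of_real (\<omega> j) *
      (cnj (residual_row n1 \<psi> \<phi> f (z j) i) * residual_row n1 \<psi> \<phi> f (z j) k -
       complex_of_real (\<sigma>\<^sup>2) * cnj (denominator_row n1 \<phi> (z j) i) * denominator_row n1 \<phi> (z j) k))"
    unfolding A_def by (intro eq_matI) (simp_all add: H_mat_index)
  from hermitian_form_of_rank_one_sum[OF this, of c]
  have "(A *\<^sub>v Matrix.vec (n1 + n2 + 2) c) \<bullet>c Matrix.vec (n1 + n2 + 2) c =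
    complex_of_real (\<Sum>j=1..r. \<omega> j *
      ((cmod (poly p (z j) - f (z j) * poly q (z j)))\<^sup>2 - \<sigma>\<^sup>2 * (cmod (poly q (z j)))\<^sup>2))"
    by (simp only: res den)
  moreover have "0 \<le> Re ((A *\<^sub>v Matrix.vec (n1 + n2 + 2) c) \<bullet>c Matrix.vec (n1 + n2 + 2) c)"
    using psd unfolding A_def[symmetric] pos_semidef_def by (simp add: A_def)
  ultimately have nonneg: "0 \<le> (\<Sum>j=1..r. \<omega> j *
      ((cmod (poly p (z j) - f (z j) * poly q (z j)))\<^sup>2 - \<sigma>\<^sup>2 * (cmod (poly q (z j)))\<^sup>2))"
    by (simp only: Re_complex_of_real)
  have "\<exists>j\<in>{1..r}. \<sigma> * cmod (poly q (z j)) \<le> cmod (f (z j) * poly q (z j) - poly p (z j))"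
  proof (rule ccontr)
    assume "\<not> ?thesis"
    then have less: "cmod (poly p (z j) - f (z j) * poly q (z j)) < \<sigma> * cmod (poly q (z j))"
      if "j \<in> {1..r}" for j
      using that by (auto simp: norm_minus_commute not_le)
    have "(\<Sum>j=1..r. \<omega> j *
      ((cmod (poly p (z j) - f (z j) * poly q (z j)))\<^sup>2 - \<sigma>\<^sup>2 * (cmod (poly q (z j)))\<^sup>2)) < (\<Sum>j=1..r. 0)"
    \<comment> \<open>Strictness needs a nonempty index set, which \<open>1 \<le> r\<close>
      provides.\<close>
    proof (rule sum_strict_mono)
      fix j assume j: "j \<in> {1..r}"
      have "(cmod (poly p (z j) - f (z j) * poly q (z j)))\<^sup>2 < (\<sigma> * cmod (poly q (z j)))\<^sup>2"
        using less[OF j] by (intro power_strict_mono) auto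
      then show "\<omega> j *
        ((cmod (poly p (z j) - f (z j) * poly q (z j)))\<^sup>2 - \<sigma>\<^sup>2 * (cmod (poly q (z j)))\<^sup>2) < 0"
        using \<omega>[OF j] by (simp add: mult_pos_neg power_mult_distrib)
    qed (use r in auto)
    with nonneg show False by simp
  qed
  then show thesis
    using z that unfolding \<sigma>_def by blast
qed

text \<open>The point \<open>z\<close> from the lower bound for a competitor \<open>\<eta>\<close>
  lies in \<open>B\<close> and is extreme for \<open>\<xi>\<close>. Comparing the two errors at
  \<open>z\<close> therefore compares the two norms on \<open>B\<close>. A competitor with a pole in
  \<open>B\<close> has infinite norm.\<close>

lemma ruttan_condition_imp_minimax:
  assumes ruttan: "ruttan_condition n1 n2 \<psi> \<phi> f \<Omega> \<xi> B"
    and bases: "poly_basis n1 \<psi>" "poly_basis n2 \<phi>"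
    and \<xi>: "\<xi> \<in> rat_class n1 n2"
    and B: "B \<subseteq> \<Omega>"
  shows "is_minimax n1 n2 f B \<xi>"
proof -
  have "err_norm f \<xi> B \<le> err_norm f \<eta> B" if \<eta>: "\<eta> \<in> rat_class n1 n2" for \<eta>
  proof (cases "rat_poles \<eta> \<inter> B = {}")
    case True
    obtain z where z: "z \<in> extreme_points f \<xi> \<Omega>" "z \<in> B" and
      le: "enn2real (err_norm f \<xi> \<Omega>) * cmod (poly (snd (quot_of_fract \<eta>)) z) \<le>
        cmod (f z * poly (snd (quot_of_fract \<eta>)) z - poly (fst (quot_of_fract \<eta>)) z)"
      using ruttan_condition_lower_bound[OF ruttan bases rat_class_degree_le[OF \<eta>]] by blast
    have q: "poly (snd (quot_of_fract \<eta>)) z \<noteq> 0"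
      using True z(2) by (auto simp: rat_poles_def)
    have "f z * poly (snd (quot_of_fract \<eta>)) z - poly (fst (quot_of_fract \<eta>)) z =
        (f z - rat_eval \<eta> z) * poly (snd (quot_of_fract \<eta>)) z"
      using q by (simp add: rat_eval_def field_simps)
    with le q have "enn2real (err_norm f \<xi> \<Omega>) \<le> cmod (f z - rat_eval \<eta> z)"
      by (simp add: norm_mult)
    then have "cmod (f z - rat_eval \<xi> z) \<le> cmod (f z - rat_eval \<eta> z)"
      by (simp add: extreme_point_modulus[OF z(1)])
    then have "ennreal (cmod (f z - rat_eval \<xi> z)) \<le> ennreal (cmod (f z - rat_eval \<eta> z))"
      by (rule ennreal_leI)
    also have "\<dots> \<le> err_norm f \<eta> B"
      using z(2) by (rule err_norm_upper)
    \<comment> \<open>The error of \<open>\<xi>\<close> at \<open>z\<close> is its norm on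
      \<open>\<Omega>\<close>, hence also its norm on \<open>B\<close>.\<close>
    finally show ?thesis
      using err_norm_subset_eq[OF z B] z(1) by (simp add: extreme_points_def)
  qed (simp add: err_norm_def)
  then have "err_norm f \<xi> B = (INF \<eta>\<in>rat_class n1 n2. err_norm f \<eta> B)"
    using \<xi> by (intro antisym INF_greatest INF_lower) auto
  then show ?thesis
    using \<xi> by (simp add: is_minimax_def)
qed

lemma ruttan_condition_restrict:
  assumes "ruttan_condition n1 n2 \<psi> \<phi> f \<Omega> \<xi> S" "extreme_points f \<xi> \<Omega> \<subseteq> T"
  shows "ruttan_condition n1 n2 \<psi> \<phi> f \<Omega> \<xi> T"
  using assms unfolding ruttan_condition_def by (meson subset_trans)

section \<open>Extreme points on a Jordan domain\<close>

text \<open>An extreme point inside the curve would be an interior maximum of the modulus. The error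
  would then be constant inside and, by continuity, on all of \<open>\<Omega>\<close>.\<close>

lemma extreme_points_subset_boundary:
  assumes jordan: "closed_jordan_domain \<Omega> \<Gamma>"
    and f: "f \<in> C_A \<Omega>"
    and nonconst: "\<not> (\<lambda>x. f x - rat_eval \<xi> x) constant_on \<Omega>"
  shows "extreme_points f \<xi> \<Omega> \<subseteq> \<Gamma>"
proof
  fix z assume z: "z \<in> extreme_points f \<xi> \<Omega>"
  obtain \<gamma> where \<gamma>: "simple_path \<gamma>" "pathfinish \<gamma> = pathstart \<gamma>" "\<Gamma> = path_image \<gamma>"
    and \<Omega>: "\<Omega> = \<Gamma> \<union> inside \<Gamma>"
    using jordan unfolding closed_jordan_domain_def by blast
  have "open (inside \<Gamma>)" and conn: "connected (inside \<Gamma>)" and fr: "frontier (inside \<Gamma>) = \<Gamma>"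
    using Jordan_inside_outside[OF \<gamma>(1,2)] by (simp_all add: \<gamma>(3))
  \<comment> \<open>By the Jordan curve theorem the whole curve is the frontier of its inside, so
    closing the inside recovers \<open>\<Omega>\<close>.\<close>
  have cl: "closure (inside \<Gamma>) = \<Omega>"
    using fr by (simp add: \<Omega> closure_Un_frontier Un_commute)
  \<comment> \<open>\<open>C_A\<close> gives analyticity on the interior of \<open>\<Omega>\<close>,
    whereas the argument runs on the inside of the curve.\<close>
  have int: "inside \<Gamma> \<subseteq> interior \<Omega>"
    using \<open>open (inside \<Gamma>)\<close> by (intro interior_maximal) (auto simp: \<Omega>)
  have rat: "rat_eval \<xi> holomorphic_on \<Omega>"
    using extreme_point_imp_no_poles[OF z] by (rule rat_eval_holomorphic_on)
  show "z \<in> \<Gamma>"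
  proof (rule ccontr)
    assume "z \<notin> \<Gamma>"
    then have z_in: "z \<in> inside \<Gamma>"
      using z \<Omega> by (auto simp: extreme_points_def)
    have "(\<lambda>x. f x - rat_eval \<xi> x) holomorphic_on inside \<Gamma>"
    proof (rule holomorphic_on_diff)
      show "f holomorphic_on inside \<Gamma>"
        using f int by (auto simp: C_A_def intro: holomorphic_on_subset analytic_imp_holomorphic)
      show "rat_eval \<xi> holomorphic_on inside \<Gamma>"
        using rat by (rule holomorphic_on_subset) (simp add: \<Omega>)
    qed
    moreover have "cmod (f x - rat_eval \<xi> x) \<le> cmod (f z - rat_eval \<xi> z)" if "x \<in> inside \<Gamma>" for x
    proof -
      have "ennreal (cmod (f x - rat_eval \<xi> x)) \<le> ennreal (cmod (f z - rat_eval \<xi> z))"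
        using err_norm_upper[of x \<Omega> f \<xi>] z that by (simp add: extreme_points_def \<Omega>)
      then show ?thesis by simp
    qed
    ultimately have "(\<lambda>x. f x - rat_eval \<xi> x) constant_on inside \<Gamma>"
      using maximum_modulus_principle[OF _ \<open>open (inside \<Gamma>)\<close> conn \<open>open (inside \<Gamma>)\<close> order_refl z_in]
      by blast
    moreover have "continuous_on (closure (inside \<Gamma>)) (\<lambda>x. f x - rat_eval \<xi> x)"
    proof (rule continuous_on_diff)
      show "continuous_on (closure (inside \<Gamma>)) f"
        using f by (simp add: cl C_A_def)
      show "continuous_on (closure (inside \<Gamma>)) (rat_eval \<xi>)"
        using rat by (simp add: cl holomorphic_on_imp_continuous_on)
    qed
    ultimately have "(\<lambda>x. f x - rat_eval \<xi> x) constant_on closure (inside \<Gamma>)"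
      by (rule constant_on_closureI)
    with nonconst cl show False by simp
  qed
qed

text \<open>Both parts are instances of \<open>ruttan_condition_imp_minimax\<close>, with
  \<open>B\<close> equal to \<open>\<Gamma>\<close> and to \<open>X\<close>. The nonconstancy
  premise serves to place the points of Ruttan's condition on \<open>\<Gamma>\<close>.\<close>

theorem theorem5p1:
  fixes n1 n2 :: nat
    and \<Omega> \<Gamma> :: "complex set"
    and f :: "complex \<Rightarrow> complex"
    and \<psi> \<phi> :: "nat \<Rightarrow> complex poly"
    and \<xi> :: "complex poly fract"
  assumes jordan: "closed_jordan_domain \<Omega> \<Gamma>"
    and f_CA: "f \<in> C_A \<Omega>"
    and f_not_rational: "\<not> agrees_with_rational_on f n1 n2 \<Omega>"
    and basis_num: "poly_basis n1 \<psi>"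
    and basis_den: "poly_basis n2 \<phi>"
    and minimax: "is_minimax n1 n2 f \<Omega> \<xi>"
    and ruttan: "ruttan_condition n1 n2 \<psi> \<phi> f \<Omega> \<xi> \<Omega>"
  shows "(\<not> (\<lambda>x. f x - rat_eval \<xi> x) constant_on \<Omega> \<longrightarrow>
            extreme_points f \<xi> \<Omega> \<subseteq> \<Gamma> \<and> is_minimax n1 n2 f \<Gamma> \<xi>) \<and>
         (\<forall>X. finite X \<and> X \<subseteq> \<Gamma> \<and> n1 + n2 + 2 \<le> card X \<and>
              ruttan_condition n1 n2 \<psi> \<phi> f \<Omega> \<xi> X \<longrightarrow>
              is_minimax n1 n2 f X \<xi>)"
proof (intro conjI impI allI)
  assume "\<not> (\<lambda>x. f x - rat_eval \<xi> x) constant_on \<Omega>"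
  with jordan f_CA show sub: "extreme_points f \<xi> \<Omega> \<subseteq> \<Gamma>"
    by (rule extreme_points_subset_boundary)
  show "is_minimax n1 n2 f \<Gamma> \<xi>"
    using ruttan_condition_restrict[OF ruttan sub] basis_num basis_den
  proof (rule ruttan_condition_imp_minimax)
    show "\<xi> \<in> rat_class n1 n2"
      using minimax by (simp add: is_minimax_def)
    show "\<Gamma> \<subseteq> \<Omega>"
      using jordan by (auto simp: closed_jordan_domain_def)
  qed
next
  fix X
  assume X: "finite X \<and> X \<subseteq> \<Gamma> \<and> n1 + n2 + 2 \<le> card X \<and> ruttan_condition n1 n2 \<psi> \<phi> f \<Omega> \<xi> X"
  \<comment> \<open>Here the points lie in \<open>X\<close> by assumption, so a constant error needs
    no separate treatment.\<close>
  then have "ruttan_condition n1 n2 \<psi> \<phi> f \<Omega> \<xi> X"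
    by blast
  then show "is_minimax n1 n2 f X \<xi>"
    using basis_num basis_den
  proof (rule ruttan_condition_imp_minimax)
    show "\<xi> \<in> rat_class n1 n2"
      using minimax by (simp add: is_minimax_def)
    show "X \<subseteq> \<Omega>"
      using X jordan by (auto simp: closed_jordan_domain_def)
  qed
qed

end
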